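(* Let $M$ be a smooth compact connected manifold, $\mathbf{A}$ a Weil algebra, and $\phi:M\to M$ a diffeomorphism, with Weil lifting $\phi^{\mathbf{A}}:M^{\mathbf{A}}\to M^{\mathbf{A}}$, $\phi^{\mathbf{A}}(\xi)(h)=\xi(h\circ\phi)$ for all $h\in C^\infty(M)$. Let $\mathrm{Fix}(\phi)=\{x\in M\mid\phi(x)=x\}$ and $\mathrm{Fix}(\phi^{\mathbf{A}})=\{\xi\in M^{\mathbf{A}}\mid\phi^{\mathbf{A}}(\xi)=\xi\}$. (i) If $\mathrm{Fix}(\phi)$ is nonempty and contains a neighborhood $W$ (a nonempty open subset of $M$), then $\mathrm{Fix}(\phi^{\mathbf{A}})$ is nonempty and contains $\bigcup_{x\in W}M^{\mathbf{A}}_x$. (ii) Conversely, if $\phi:M\to M$ is a diffeomorphism such that $\mathrm{Fix}(\phi^{\mathbf{A}})\neq\emptyset$, then $\pi_{\mathbf{A}}(\mathrm{Fix}(\phi^{\mathbf{A}}))\subseteq\mathrm{Fix}(\phi)$.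
   Context: A Weil algebra is a finite-dimensional, commutative, associative, unital $\mathbb{R}$-algebra $\mathbf{A}=\mathbb{R}\oplus\mathcal{A}$, where $\mathcal{A}$ is a maximal ideal with $\mathcal{A}^{k+1}=0$ for some $k\ge 1$. For a smooth manifold $M$ and $x\in M$, $M^{\mathbf{A}}_x$ is the set of $\mathbb{R}$-algebra morphisms $\xi:C^\infty(M)\to\mathbf{A}$ with $\mathrm{pr}_{\mathbb{R}}\circ\xi=\mathrm{ev}_x$, where $\mathrm{ev}_x(f)=f(x)$ and $\mathrm{pr}_{\mathbb{R}}:\mathbf{A}\to\mathbb{R}$ is the projection along $\mathcal{A}$. The Weil bundle is $M^{\mathbf{A}}=\bigcup_{x\in M}M^{\mathbf{A}}_x$, with projection $\pi_{\mathbf{A}}:M^{\mathbf{A}}\to M$ sending $\xi\in M^{\mathbf{A}}_x$ to $x$. *)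

theory Defs
  imports "HOL-Analysis.Analysis"
begin

section \<open>Smooth maps between open subsets of model spaces\<close>

text \<open>
  \<open>Ck_on k S f\<close>: \<open>f\<close> is of class \<open>C\<^sup>k\<close> on the open set \<open>S\<close>. The derivative is required to be of
  class \<open>C\<^sup>k\<^sup>-\<^sup>1\<close> direction by direction, which in finite dimension is the same as requiring it for
  the operator-valued derivative.
\<close>

primrec Ck_on :: "nat \<Rightarrow> 'a::real_normed_vector set \<Rightarrow> ('a \<Rightarrow> 'b::real_normed_vector) \<Rightarrow> bool" where
  "Ck_on 0 S f \<longleftrightarrow> continuous_on S f"
| "Ck_on (Suc k) S f \<longleftrightarrow>
     (\<forall>x\<in>S. f differentiable (at x)) \<and> (\<forall>v. Ck_on k S (\<lambda>x. frechet_derivative f (at x) v))"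

definition smooth_on :: "'a::real_normed_vector set \<Rightarrow> ('a \<Rightarrow> 'b::real_normed_vector) \<Rightarrow> bool" where
  "smooth_on S f \<longleftrightarrow> (\<forall>k. Ck_on k S f)"

section \<open>Smooth manifolds\<close>

text \<open>
  The underlying topological space of a manifold is a whole type. The model space is a
  finite-dimensional real inner product space rather than an instance of \<open>euclidean_space\<close>,
  because the latter class excludes dimension 0. A chart is a pair of its domain and its
  coordinate map; the values of the coordinate map outside the domain are irrelevant.
\<close>

type_synonym ('m, 'e) chart = "'m set \<times> ('m \<Rightarrow> 'e)"

locale smooth_manifold =
  fixes atlas :: "('m::{t2_space, second_countable_topology}, 'e::real_inner) chart set"
  assumes finite_dim: "\<exists>B::'e set. finite B \<and> span B = UNIV"
    and chart: "(U, f) \<in> atlas \<Longrightarrow> open U \<and> open (f ` U) \<and> (\<exists>g. homeomorphism U (f ` U) f g)"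
    and cover: "(\<Union>(U, f)\<in>atlas. U) = UNIV"
    and compatible: "(U, f) \<in> atlas \<Longrightarrow> (V, g) \<in> atlas \<Longrightarrow>
      smooth_on (f ` (U \<inter> V)) (g \<circ> inv_into U f)"

definition C_inf ::
    "('m::{t2_space, second_countable_topology}, 'e::real_inner) chart set \<Rightarrow> ('m \<Rightarrow> real) set" where
  "C_inf atlas = {h. \<forall>(U, f)\<in>atlas. smooth_on (f ` U) (h \<circ> inv_into U f)}"

definition smooth_map ::
    "('m::{t2_space, second_countable_topology}, 'e::real_inner) chart set \<Rightarrow>
     ('n::{t2_space, second_countable_topology}, 'f::real_inner) chart set \<Rightarrow> ('m \<Rightarrow> 'n) \<Rightarrow> bool" where
  "smooth_map atlas atlas' \<phi> \<longleftrightarrow>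
     continuous_on UNIV \<phi> \<and>
     (\<forall>(U, f)\<in>atlas. \<forall>(V, g)\<in>atlas'. smooth_on (f ` (U \<inter> \<phi> -` V)) (g \<circ> \<phi> \<circ> inv_into U f))"

definition diffeomorphism ::
    "('m::{t2_space, second_countable_topology}, 'e::real_inner) chart set \<Rightarrow>
     ('n::{t2_space, second_countable_topology}, 'f::real_inner) chart set \<Rightarrow> ('m \<Rightarrow> 'n) \<Rightarrow> bool" where
  "diffeomorphism atlas atlas' \<phi> \<longleftrightarrow>
     bij \<phi> \<and> smooth_map atlas atlas' \<phi> \<and> smooth_map atlas' atlas (inv \<phi>)"

section \<open>Weil algebras\<close>

definition is_ideal :: "'w::comm_ring_1 set \<Rightarrow> bool" where
  "is_ideal I \<longleftrightarrow> 0 \<in> I \<and> (\<forall>a\<in>I. \<forall>b\<in>I. a + b \<in> I) \<and> (\<forall>r. \<forall>a\<in>I. r * a \<in> I)"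

definition is_maximal_ideal :: "'w::comm_ring_1 set \<Rightarrow> bool" where
  "is_maximal_ideal I \<longleftrightarrow> is_ideal I \<and> I \<noteq> UNIV \<and> (\<forall>J. is_ideal J \<and> I \<subseteq> J \<longrightarrow> J = I \<or> J = UNIV)"

text \<open>
  Ideals of a real algebra are linear subspaces, so the product of two ideals is the linear span
  of the products of their elements.
\<close>

primrec ideal_power :: "'w::{comm_ring_1, real_algebra_1} set \<Rightarrow> nat \<Rightarrow> 'w set" where
  "ideal_power I 0 = UNIV"
| "ideal_power I (Suc k) = span {a * b | a b. a \<in> I \<and> b \<in> ideal_power I k}"

text \<open>
  The algebra is a whole type; \<open>\<N>\<close> is its maximal ideal. The last two assumptions express the
  direct sum decomposition into the real multiples of the unit and \<open>\<N>\<close>.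
\<close>

locale weil_algebra =
  fixes \<N> :: "'w::{comm_ring_1, real_algebra_1} set"
  assumes finite_dim: "\<exists>B::'w set. finite B \<and> span B = UNIV"
    and maximal: "is_maximal_ideal \<N>"
    and nilpotent: "\<exists>k\<ge>1. ideal_power \<N> (k + 1) = {0}"
    and sum_UNIV: "{of_real r + n | r n. n \<in> \<N>} = UNIV"
    and inter_zero: "range of_real \<inter> \<N> = {0}"

text \<open>The projection onto the real part along \<open>\<N>\<close>.\<close>

definition pr_real :: "'w::{comm_ring_1, real_algebra_1} set \<Rightarrow> 'w \<Rightarrow> real" where
  "pr_real \<N> a = (THE r. \<exists>n\<in>\<N>. a = of_real r + n)"

section \<open>Weil bundles\<close>

text \<open>
  Morphisms are functions on \<open>C_inf atlas\<close>. They are represented by total functions that take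
  the value \<open>undefined\<close> outside that set, so that equality of morphisms is equality in the logic.
\<close>

definition algebra_morphism ::
    "('m::{t2_space, second_countable_topology}, 'e::real_inner) chart set \<Rightarrow>
     (('m \<Rightarrow> real) \<Rightarrow> 'w::{comm_ring_1, real_algebra_1}) \<Rightarrow> bool" where
  "algebra_morphism atlas \<xi> \<longleftrightarrow>
     \<xi> \<in> extensional (C_inf atlas) \<and>
     (\<forall>f\<in>C_inf atlas. \<forall>g\<in>C_inf atlas. \<xi> (\<lambda>x. f x + g x) = \<xi> f + \<xi> g) \<and>
     (\<forall>c. \<forall>f\<in>C_inf atlas. \<xi> (\<lambda>x. c * f x) = c *\<^sub>R \<xi> f) \<and>
     (\<forall>f\<in>C_inf atlas. \<forall>g\<in>C_inf atlas. \<xi> (\<lambda>x. f x * g x) = \<xi> f * \<xi> g) \<and>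
     \<xi> (\<lambda>x. 1) = 1"

definition weil_fibre ::
    "('m::{t2_space, second_countable_topology}, 'e::real_inner) chart set \<Rightarrow>
     'w::{comm_ring_1, real_algebra_1} set \<Rightarrow> 'm \<Rightarrow> (('m \<Rightarrow> real) \<Rightarrow> 'w) set" where
  "weil_fibre atlas \<N> x =
     {\<xi>. algebra_morphism atlas \<xi> \<and> (\<forall>f\<in>C_inf atlas. pr_real \<N> (\<xi> f) = f x)}"

definition weil_bundle ::
    "('m::{t2_space, second_countable_topology}, 'e::real_inner) chart set \<Rightarrow>
     'w::{comm_ring_1, real_algebra_1} set \<Rightarrow> (('m \<Rightarrow> real) \<Rightarrow> 'w) set" where
  "weil_bundle atlas \<N> = (\<Union>x. weil_fibre atlas \<N> x)"

definition weil_proj ::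
    "('m::{t2_space, second_countable_topology}, 'e::real_inner) chart set \<Rightarrow>
     'w::{comm_ring_1, real_algebra_1} set \<Rightarrow> (('m \<Rightarrow> real) \<Rightarrow> 'w) \<Rightarrow> 'm" where
  "weil_proj atlas \<N> \<xi> = (THE x. \<xi> \<in> weil_fibre atlas \<N> x)"

definition weil_lift ::
    "('m::{t2_space, second_countable_topology}, 'e::real_inner) chart set \<Rightarrow> ('m \<Rightarrow> 'm) \<Rightarrow>
     (('m \<Rightarrow> real) \<Rightarrow> 'w::{comm_ring_1, real_algebra_1}) \<Rightarrow> (('m \<Rightarrow> real) \<Rightarrow> 'w)" where
  "weil_lift atlas \<phi> \<xi> = restrict (\<lambda>h. \<xi> (h \<circ> \<phi>)) (C_inf atlas)"

section \<open>Fixed points\<close>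

definition Fix :: "'m set \<Rightarrow> ('m \<Rightarrow> 'm) \<Rightarrow> 'm set" where
  "Fix A f = {x\<in>A. f x = x}"

end

theory Submission
  imports Defs
begin

text \<open>
  Everything rests on the existence of smooth bump functions: for an open \<open>W\<close> and \<open>x \<in> W\<close>
  there is \<open>u \<in> C\<^sup>\<infinity>(M)\<close> with \<open>u(x) \<noteq> 0\<close> that vanishes outside \<open>W\<close>
  (\<open>bump_function\<close>). It has two consequences.

  First, a morphism \<open>\<xi>\<close> over \<open>x\<close> depends only on germs at \<open>x\<close> (\<open>weil_fibre_local\<close>). If
  \<open>h = k\<close> on \<open>W\<close>, then \<open>u (h - k) = 0\<close>, hence \<open>\<xi>(u) (\<xi>(h) - \<xi>(k)) = 0\<close>. The real part of
  \<open>\<xi>(u)\<close> is \<open>u(x) \<noteq> 0\<close>, and elements of a Weil algebra with nonzero real part are units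
  (\<open>mult_eq_0_pr_real\<close>), so \<open>\<xi>(h) = \<xi>(k)\<close>. When \<open>\<phi>\<close> is the identity on \<open>W\<close>, this applies to
  \<open>h \<circ> \<phi>\<close> and \<open>h\<close>, and every \<open>\<xi>\<close> over a point of \<open>W\<close> is fixed by the lift. Such
  \<open>\<xi>\<close> exist, because evaluation at a point followed by the unit map of the algebra is one.

  Second, smooth functions separate points (\<open>C_inf_separates_points\<close>). If \<open>\<xi>\<close> over \<open>x\<close> is fixed,
  then taking real parts in \<open>\<xi>(h \<circ> \<phi>) = \<xi>(h)\<close> gives \<open>h(\<phi>(x)) = h(x)\<close> for all smooth \<open>h\<close>,
  hence \<open>\<phi>(x) = x\<close>. Separation also makes the base point of \<open>\<xi>\<close> unique.

  Both arguments use that \<open>h \<circ> \<phi>\<close> is smooth (\<open>C_inf_compose\<close>), which comes down to the chain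
  rule for maps of class \<open>C\<^sup>k\<close> (\<open>Ck_on_compose\<close>).
\<close>

section \<open>Calculus of maps of class \<open>C\<^sup>k\<close>\<close>

lemma Ck_on_cong:
  assumes "open S" "\<And>x. x \<in> S \<Longrightarrow> f x = g x" "Ck_on k S f"
  shows "Ck_on k S g"
  using assms(2,3)
proof (induction k arbitrary: f g)
  case 0
  then show ?case by (auto cong: continuous_on_cong)
next
  case (Suc k)
  have D: "(g has_derivative frechet_derivative f (at x)) (at x)" if "x \<in> S" for x
  proof -
    have "(f has_derivative frechet_derivative f (at x)) (at x)"
      using Suc.prems(2) that frechet_derivative_works by auto
    then show ?thesis
      by (rule has_derivative_transform_within_open[OF _ assms(1) that]) (use Suc.prems(1) in auto)
  qed
  have "Ck_on k S (\<lambda>x. frechet_derivative g (at x) v)" for v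
  proof (rule Suc.IH)
    show "Ck_on k S (\<lambda>x. frechet_derivative f (at x) v)"
      using Suc.prems(2) by simp
    show "frechet_derivative f (at x) v = frechet_derivative g (at x) v" if "x \<in> S" for x
      using frechet_derivative_at[OF D[OF that]] by simp
  qed
  then show ?case
    using D by (auto simp: differentiable_def)
qed

lemma Ck_on_SucI:
  assumes "open S" "\<And>x. x \<in> S \<Longrightarrow> (f has_derivative f' x) (at x)"
    and "\<And>v. Ck_on k S (\<lambda>x. f' x v)"
  shows "Ck_on (Suc k) S f"
proof -
  have "Ck_on k S (\<lambda>x. frechet_derivative f (at x) v)" for v
    by (rule Ck_on_cong[OF assms(1) _ assms(3)[of v]])
       (use frechet_derivative_at[OF assms(2)] in auto)
  then show ?thesis
    using assms(2) by (auto simp: differentiable_def)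
qed

lemma Ck_on_SucD:
  assumes "Ck_on (Suc k) S f"
  shows "x \<in> S \<Longrightarrow> (f has_derivative frechet_derivative f (at x)) (at x)"
    and "Ck_on k S (\<lambda>x. frechet_derivative f (at x) v)"
  using assms frechet_derivative_works by auto

lemma Ck_on_lower: "Ck_on (Suc k) S f \<Longrightarrow> Ck_on k S f"
proof (induction k arbitrary: f)
  case 0
  then show ?case
    by (auto intro!: continuous_at_imp_continuous_on differentiable_imp_continuous_within)
next
  case (Suc k)
  then have "Ck_on k S (\<lambda>x. frechet_derivative f (at x) v)" for v
    by (metis Ck_on.simps(2))
  with Suc.prems show ?case
    by (metis Ck_on.simps(2))
qed

lemma Ck_on_local:
  assumes "\<And>x. x \<in> S \<Longrightarrow> \<exists>T. open T \<and> x \<in> T \<and> Ck_on k T f"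
  shows "Ck_on k S f"
  using assms
proof (induction k arbitrary: f)
  case 0
  have "isCont f x" if "x \<in> S" for x
    using 0[OF that] continuous_on_eq_continuous_at by fastforce
  then show ?case
    by (simp add: continuous_at_imp_continuous_on)
next
  case (Suc k)
  have "Ck_on k S (\<lambda>x. frechet_derivative f (at x) v)" for v
    by (rule Suc.IH) (use Suc.prems in fastforce)
  moreover have "f differentiable (at x)" if "x \<in> S" for x
    using Suc.prems[OF that] by auto
  ultimately show ?case by simp
qed

lemma Ck_on_const: "open S \<Longrightarrow> Ck_on k S (\<lambda>x. c)"
proof (induction k arbitrary: c)
  case (Suc k)
  then show ?case
    by (intro Ck_on_SucI[where f' = "\<lambda>x v. 0"]) auto
qed simp

lemma Ck_on_add:
  assumes "open S" "Ck_on k S f" "Ck_on k S g"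
  shows "Ck_on k S (\<lambda>x. f x + g x)"
  using assms(2,3)
proof (induction k arbitrary: f g)
  case 0
  then show ?case by (auto intro: continuous_intros)
next
  case (Suc k)
  note D = Ck_on_SucD[OF Suc.prems(1)] Ck_on_SucD[OF Suc.prems(2)]
  show ?case
    by (rule Ck_on_SucI[OF assms(1) has_derivative_add[OF D(1,3)] Suc.IH[OF D(2,4)]])
qed

lemma Ck_on_sum:
  assumes "open S" "\<And>i. i \<in> I \<Longrightarrow> Ck_on k S (f i)"
  shows "Ck_on k S (\<lambda>x. \<Sum>i\<in>I. f i x)"
  using assms(2)
  by (induction I rule: infinite_finite_induct) (auto intro: Ck_on_const Ck_on_add assms(1))

lemma Ck_on_bounded_linear:
  assumes "bounded_linear L" "open S" "Ck_on k S f"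
  shows "Ck_on k S (\<lambda>x. L (f x))"
  using assms(3)
proof (induction k arbitrary: f)
  case 0
  then show ?case by (auto intro: bounded_linear.continuous_on[OF assms(1)])
next
  case (Suc k)
  note D = Ck_on_SucD[OF Suc.prems]
  show ?case
    by (rule Ck_on_SucI[OF assms(2) bounded_linear.has_derivative[OF assms(1) D(1)] Suc.IH[OF D(2)]])
qed

lemma Ck_on_bounded_bilinear:
  assumes "bounded_bilinear B" "open S" "Ck_on k S f" "Ck_on k S g"
  shows "Ck_on k S (\<lambda>x. B (f x) (g x))"
  using assms(3,4)
proof (induction k arbitrary: f g)
  case 0
  then show ?case by (auto intro: bounded_bilinear.continuous_on[OF assms(1)])
next
  case (Suc k)
  note D = Ck_on_SucD[OF Suc.prems(1)] Ck_on_SucD[OF Suc.prems(2)]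
  note low = Suc.prems[THEN Ck_on_lower]
  show ?case
    by (rule Ck_on_SucI[OF assms(2) bounded_bilinear.FDERIV[OF assms(1) D(1,3)]])
       (auto intro!: Ck_on_add assms(2) Suc.IH D low)
qed

lemma Ck_on_id: "open S \<Longrightarrow> Ck_on k S (\<lambda>x. x)"
proof (cases k)
  case (Suc l)
  assume "open S"
  then show ?thesis
    unfolding Suc by (intro Ck_on_SucI[where f' = "\<lambda>x v. v"] Ck_on_const) auto
qed simp

lemma orthogonal_expansion:
  fixes C :: "'a::real_inner set"
  assumes "finite C" "pairwise orthogonal C" "v \<in> span C"
  shows "v = (\<Sum>b\<in>C. ((v \<bullet> b) / (b \<bullet> b)) *\<^sub>R b)"
  using assms(3)
proof (induction rule: span_induct)
  case base
  show ?case
  proof (rule subspaceI)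
    show "0 \<in> {v. v = (\<Sum>b\<in>C. ((v \<bullet> b) / (b \<bullet> b)) *\<^sub>R b)}"
      by simp
  next
    fix x y
    assume "x \<in> {v. v = (\<Sum>b\<in>C. ((v \<bullet> b) / (b \<bullet> b)) *\<^sub>R b)}"
      and "y \<in> {v. v = (\<Sum>b\<in>C. ((v \<bullet> b) / (b \<bullet> b)) *\<^sub>R b)}"
    moreover have "(\<Sum>b\<in>C. (((x + y) \<bullet> b) / (b \<bullet> b)) *\<^sub>R b) =
        (\<Sum>b\<in>C. ((x \<bullet> b) / (b \<bullet> b)) *\<^sub>R b) + (\<Sum>b\<in>C. ((y \<bullet> b) / (b \<bullet> b)) *\<^sub>R b)"
      by (simp only: inner_add_left add_divide_distrib scaleR_add_left sum.distrib)
    ultimately show "x + y \<in> {v. v = (\<Sum>b\<in>C. ((v \<bullet> b) / (b \<bullet> b)) *\<^sub>R b)}"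
      by simp
  next
    fix r x
    assume "x \<in> {v. v = (\<Sum>b\<in>C. ((v \<bullet> b) / (b \<bullet> b)) *\<^sub>R b)}"
    moreover have "(\<Sum>b\<in>C. (((r *\<^sub>R x) \<bullet> b) / (b \<bullet> b)) *\<^sub>R b) =
        r *\<^sub>R (\<Sum>b\<in>C. ((x \<bullet> b) / (b \<bullet> b)) *\<^sub>R b)"
      by (simp add: scaleR_sum_right)
    ultimately show "r *\<^sub>R x \<in> {v. v = (\<Sum>b\<in>C. ((v \<bullet> b) / (b \<bullet> b)) *\<^sub>R b)}"
      by simp
  qed
next
  case (step c)
  have "(\<Sum>b\<in>C. ((c \<bullet> b) / (b \<bullet> b)) *\<^sub>R b) = (\<Sum>b\<in>C. if b = c then c else 0)"
  proof (rule sum.cong)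
    fix b assume "b \<in> C"
    then show "((c \<bullet> b) / (b \<bullet> b)) *\<^sub>R b = (if b = c then c else 0)"
      using assms(2) step by (cases "b = 0") (auto simp: pairwise_def orthogonal_def)
  qed simp
  then show ?case
    using step assms(1) by simp
qed

text \<open>
  The \<open>C\<^sup>k\<close> condition speaks about derivatives in fixed directions, but the chain rule evaluates
  the derivative of the outer map in the moving direction \<open>Df(x) v\<close>. Expanding this
  direction in an orthogonal basis of the intermediate space turns the derivative of the composite
  into a finite sum of products of maps of class \<open>C\<^sup>k\<close>; this is where finite dimension enters.
\<close>

lemma Ck_on_compose:
  fixes f :: "'a::real_normed_vector \<Rightarrow> 'b::real_inner" and g :: "'b \<Rightarrow> 'c::real_normed_vector"
  assumes B: "finite B" "span B = (UNIV :: 'b set)"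
    and S: "open S" and T: "f ` S \<subseteq> T"
    and "Ck_on k T g" "Ck_on k S f"
  shows "Ck_on k S (\<lambda>x. g (f x))"
  using assms(5,6)
proof (induction k arbitrary: g)
  case 0
  then show ?case using T by (auto intro: continuous_on_compose2)
next
  case (Suc k)
  obtain C where C: "finite C" "span C = (UNIV :: 'b set)" "pairwise orthogonal C"
    using basis_orthogonal[OF B(1)] B(2) by metis
  note Dg = Ck_on_SucD[OF Suc.prems(1)] and Df = Ck_on_SucD[OF Suc.prems(2)]
  let ?f' = "\<lambda>x. frechet_derivative f (at x)" and ?g' = "\<lambda>y. frechet_derivative g (at y)"
  let ?D = "\<lambda>x v. \<Sum>b\<in>C. ((?f' x v \<bullet> b) / (b \<bullet> b)) *\<^sub>R ?g' (f x) b"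
  show ?case
  proof (rule Ck_on_SucI[OF S])
    fix x assume x: "x \<in> S"
    then have g': "(g has_derivative ?g' (f x)) (at (f x))"
      using Dg(1) T by blast
    then interpret g': bounded_linear "?g' (f x)"
      by (rule has_derivative_bounded_linear)
    have expand: "?g' (f x) w = (\<Sum>b\<in>C. ((w \<bullet> b) / (b \<bullet> b)) *\<^sub>R ?g' (f x) b)" for w
      using arg_cong[OF orthogonal_expansion[OF C(1,3), of w], of "?g' (f x)"] C(2)
      by (simp add: g'.sum g'.scaleR)
    have "?D x = (\<lambda>v. ?g' (f x) (?f' x v))"
      by (rule ext) (rule expand[symmetric])
    then show "((\<lambda>x. g (f x)) has_derivative ?D x) (at x)"
      using has_derivative_compose[OF Df(1)[OF x] g'] by (simp only:)
  next
    fix v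
    show "Ck_on k S (\<lambda>x. ?D x v)"
    proof (intro Ck_on_sum Ck_on_bounded_bilinear[OF bounded_bilinear_scaleR] S)
      fix b
      show "Ck_on k S (\<lambda>x. (?f' x v \<bullet> b) / (b \<bullet> b))"
        by (rule Ck_on_bounded_linear[OF _ S Df(2)])
           (auto intro: bounded_linear_intros bounded_linear_compose[OF bounded_linear_divide])
      show "Ck_on k S (\<lambda>x. ?g' (f x) b)"
        by (rule Suc.IH[OF Dg(2) Ck_on_lower[OF Suc.prems(2)]])
    qed
  qed
qed

section \<open>A flat smooth function\<close>

text \<open>
  Writing \<open>h\<^sub>n\<close> for the member with index \<open>n\<close>, the derivative of each member is a linear
  combination of others, \<open>h\<^sub>n' = h\<^sub>n\<^sub>+\<^sub>2 - n h\<^sub>n\<^sub>+\<^sub>1\<close>, so all members are smooth as soon as this formula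
  is known, at the origin as well. The member \<open>h\<^sub>0\<close> is the usual smooth step.
\<close>

definition flat_exp :: "nat \<Rightarrow> real \<Rightarrow> real" where
  "flat_exp n t = (if t \<le> 0 then 0 else exp (- (1 / t)) / t ^ n)"

lemma flat_exp_tendsto_0: "(flat_exp n \<longlongrightarrow> 0) (at 0)"
proof -
  have "((\<lambda>t. inverse t ^ n / exp (inverse t)) \<longlongrightarrow> 0) (at_right (0::real))"
    by (rule filterlim_compose[OF tendsto_power_div_exp_0 filterlim_inverse_at_top_right])
  moreover have "\<forall>\<^sub>F t in at_right 0. inverse t ^ n / exp (inverse t) = flat_exp n t"
    unfolding eventually_at_right_field
    by (intro exI[of _ 1])
       (auto simp: flat_exp_def exp_minus field_simps power_inverse inverse_eq_divide)
  ultimately have "(flat_exp n \<longlongrightarrow> 0) (at_right 0)"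
    by (rule Lim_transform_eventually)
  moreover have "(flat_exp n \<longlongrightarrow> 0) (at_left 0)"
    by (rule tendsto_eventually)
       (auto simp: eventually_at_left_field flat_exp_def intro: exI[of _ "-1"])
  ultimately show ?thesis
    by (simp add: filterlim_split_at)
qed

lemma flat_exp_has_field_derivative:
  "(flat_exp n has_field_derivative flat_exp (n + 2) t - real n * flat_exp (n + 1) t) (at t)"
proof -
  consider "t < 0" | "t = 0" | "t > 0" by linarith
  then show ?thesis
  proof cases
    case 1
    have "((\<lambda>t. 0) has_field_derivative flat_exp (n + 2) t - real n * flat_exp (n + 1) t) (at t)"
      using 1 by (simp add: flat_exp_def)
    then show ?thesis
      by (rule has_field_derivative_transform_within_open[of _ _ _ "{..<0}"])
         (use 1 in \<open>auto simp: flat_exp_def\<close>)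
  next
    case 2
    \<comment> \<open>The difference quotient at the origin is again a member of the family.\<close>
    have "(\<lambda>h. (flat_exp n (0 + h) - flat_exp n 0) / h) = flat_exp (n + 1)"
      by (auto simp: flat_exp_def)
    then show ?thesis
      using flat_exp_tendsto_0[of "n + 1"] 2 by (simp add: DERIV_def flat_exp_def)
  next
    case 3
    have "((\<lambda>t. exp (- (1 / t)) / t ^ n) has_field_derivative
        flat_exp (n + 2) t - real n * flat_exp (n + 1) t) (at t)"
    proof -
      have *: "real n * t ^ (n - 1) = real n * t ^ n / t"
        using 3 by (cases n) auto
      have **: "(exp (- (1 / t)) * (1 / t\<^sup>2) * t ^ n - exp (- (1 / t)) * (real n * t ^ n / t))
          / (t ^ n * t ^ n) = flat_exp (n + 2) t - real n * flat_exp (n + 1) t"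
        using 3 by (simp add: flat_exp_def field_simps power2_eq_square)
      have "((\<lambda>t. exp (- (1 / t)) / t ^ n) has_field_derivative
          (exp (- (1 / t)) * (1 / t\<^sup>2) * t ^ n - exp (- (1 / t)) * (real n * t ^ (n - 1)))
            / (t ^ n * t ^ n)) (at t)"
        using 3 by (auto intro!: derivative_eq_intros simp: power2_eq_square)
      then show ?thesis
        by (simp only: * **)
    qed
    then show ?thesis
      by (rule has_field_derivative_transform_within_open[of _ _ _ "{0<..}"])
         (use 3 in \<open>auto simp: flat_exp_def\<close>)
  qed
qed

lemma Ck_on_flat_exp: "Ck_on k UNIV (flat_exp n)"
proof (induction k arbitrary: n)
  case 0
  show ?case
    using DERIV_isCont[OF flat_exp_has_field_derivative]
    by (auto intro: continuous_at_imp_continuous_on)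
next
  case (Suc k)
  have "Ck_on k UNIV (\<lambda>t. flat_exp (n + 2) t + (- real n) * flat_exp (n + 1) t)"
    by (intro Ck_on_add Ck_on_bounded_linear[OF bounded_linear_mult_right] Suc.IH) auto
  then have "Ck_on k UNIV (\<lambda>t. (flat_exp (n + 2) t - real n * flat_exp (n + 1) t) * v)" for v
    by (intro Ck_on_bounded_linear[OF bounded_linear_mult_left]) auto
  then show ?case
    by (rule Ck_on_SucI[OF open_UNIV flat_exp_has_field_derivative[unfolded has_field_derivative_def]])
qed

lemma smooth_bump:
  fixes p :: "'e::real_inner"
  shows "smooth_on UNIV (\<lambda>y. flat_exp 0 (r\<^sup>2 - (y - p) \<bullet> (y - p)))"
  unfolding smooth_on_def
proof
  fix k
  have id: "Ck_on k UNIV (\<lambda>y::'e. y + (- p))"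
    by (intro Ck_on_add Ck_on_id Ck_on_const) auto
  have "Ck_on k UNIV (\<lambda>y. r\<^sup>2 + (- ((y + (- p)) \<bullet> (y + (- p)))))"
    by (intro Ck_on_add Ck_on_const Ck_on_bounded_linear[OF bounded_linear_minus[OF bounded_linear_ident]]
        Ck_on_bounded_bilinear[OF bounded_bilinear_inner] id) auto
  then have "Ck_on k UNIV (\<lambda>y. r\<^sup>2 - (y - p) \<bullet> (y - p))"
    by simp
  moreover have "span {1::real} = UNIV"
    using real_scaleR_def by (auto simp: span_singleton)
  ultimately show "Ck_on k UNIV (\<lambda>y. flat_exp 0 (r\<^sup>2 - (y - p) \<bullet> (y - p)))"
    using Ck_on_compose[where B = "{1::real}" and S = UNIV and T = UNIV and g = "flat_exp 0"
        and f = "\<lambda>y. r\<^sup>2 - (y - p) \<bullet> (y - p)"] Ck_on_flat_exp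
    by simp
qed

lemma smooth_on_cong:
  assumes "open S" "\<And>x. x \<in> S \<Longrightarrow> f x = g x" "smooth_on S f"
  shows "smooth_on S g"
  unfolding smooth_on_def
proof
  fix k
  show "Ck_on k S g"
    by (rule Ck_on_cong[OF assms(1,2)]) (use assms(3) in \<open>simp_all add: smooth_on_def\<close>)
qed

lemma smooth_on_local:
  assumes "\<And>x. x \<in> S \<Longrightarrow> \<exists>T. open T \<and> x \<in> T \<and> smooth_on T f"
  shows "smooth_on S f"
  unfolding smooth_on_def
proof
  fix k
  show "Ck_on k S f"
    by (rule Ck_on_local) (use assms in \<open>metis smooth_on_def\<close>)
qed

section \<open>Smooth functions on a manifold\<close>

context smooth_manifold
begin

lemma chart_inj: "(U, f) \<in> atlas \<Longrightarrow> inj_on f U"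
  using chart[of U f] unfolding homeomorphism_def by (metis inj_on_inverseI)

lemma chart_open_image:
  assumes "(U, f) \<in> atlas" "open P"
  shows "open (f ` (U \<inter> P))"
proof -
  obtain g where g: "homeomorphism U (f ` U) f g" and U: "open U" "open (f ` U)"
    using chart[OF assms(1)] by auto
  have "openin (top_of_set U) (U \<inter> P)"
    using assms(2) by (simp add: openin_open_Int)
  from homeomorphism_imp_open_map[OF g this] U(2) show ?thesis
    using openin_open_trans by blast
qed

lemma chart_at: obtains U f where "(U, f) \<in> atlas" "x \<in> U"
  using cover by fastforce

lemma smooth_on_compose:
  fixes f :: "'a::real_normed_vector \<Rightarrow> 'e" and g :: "'e \<Rightarrow> 'c::real_normed_vector"
  assumes "open S" "f ` S \<subseteq> T" "smooth_on T g" "smooth_on S f"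
  shows "smooth_on S (\<lambda>x. g (f x))"
  using finite_dim assms Ck_on_compose[of _ S f T _ g] unfolding smooth_on_def by metis

lemma C_inf_localI:
  assumes "\<And>V g y. (V, g) \<in> atlas \<Longrightarrow> y \<in> V \<Longrightarrow>
    \<exists>P. open P \<and> y \<in> P \<and> smooth_on (g ` (V \<inter> P)) (h \<circ> inv_into V g)"
  shows "h \<in> C_inf atlas"
  unfolding C_inf_def
proof (clarify)
  fix V g assume V: "(V, g) \<in> atlas"
  show "smooth_on (g ` V) (h \<circ> inv_into V g)"
  proof (rule smooth_on_local)
    fix q assume "q \<in> g ` V"
    then obtain y where y: "y \<in> V" "q = g y" by auto
    then obtain P where "open P" "y \<in> P" "smooth_on (g ` (V \<inter> P)) (h \<circ> inv_into V g)"
      using assms[OF V] by blast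
    then show "\<exists>T. open T \<and> q \<in> T \<and> smooth_on T (h \<circ> inv_into V g)"
      using y chart_open_image[OF V] by blast
  qed
qed

lemma open_chart_image: "(U, f) \<in> atlas \<Longrightarrow> open (f ` U)"
  using chart by blast

lemma C_inf_iff:
  "h \<in> C_inf atlas \<longleftrightarrow> (\<forall>(U, f)\<in>atlas. \<forall>k. Ck_on k (f ` U) (\<lambda>q. h (inv_into U f q)))"
  by (simp add: C_inf_def smooth_on_def o_def)

lemma C_inf_const: "(\<lambda>x. c) \<in> C_inf atlas"
  unfolding C_inf_iff by (clarify, rule Ck_on_const[OF open_chart_image])

lemma C_inf_add:
  assumes "h \<in> C_inf atlas" "k \<in> C_inf atlas"
  shows "(\<lambda>x. h x + k x) \<in> C_inf atlas"
  unfolding C_inf_iff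
  by (clarify, rule Ck_on_add[OF open_chart_image]) (use assms in \<open>auto simp: C_inf_iff\<close>)

lemma C_inf_mult:
  assumes "h \<in> C_inf atlas" "k \<in> C_inf atlas"
  shows "(\<lambda>x. h x * k x) \<in> C_inf atlas"
  unfolding C_inf_iff
  by (clarify, rule Ck_on_bounded_bilinear[OF bounded_bilinear_mult open_chart_image])
     (use assms in \<open>auto simp: C_inf_iff\<close>)

lemma C_inf_cmult: "h \<in> C_inf atlas \<Longrightarrow> (\<lambda>x. c * h x) \<in> C_inf atlas"
  by (rule C_inf_mult[OF C_inf_const])

lemma C_inf_compose:
  assumes "smooth_map atlas atlas \<phi>" "h \<in> C_inf atlas"
  shows "h \<circ> \<phi> \<in> C_inf atlas"
proof (rule C_inf_localI)
  fix U f y assume U: "(U, f) \<in> atlas" and y: "y \<in> U"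
  obtain V g where V: "(V, g) \<in> atlas" "\<phi> y \<in> V"
    using chart_at by blast
  let ?P = "\<phi> -` V"
  have P: "open ?P"
    using assms(1) chart[OF V(1)] by (auto simp: smooth_map_def intro: open_vimage)
  have inv: "inv_into U f (f z) = z" if "z \<in> U" for z
    using chart_inj[OF U] that by (rule inv_into_f_f)
  have inv': "inv_into V g (g z) = z" if "z \<in> V" for z
    using chart_inj[OF V(1)] that by (rule inv_into_f_f)
  have op: "open (f ` (U \<inter> ?P))"
    by (rule chart_open_image[OF U P])
  have inner: "smooth_on (f ` (U \<inter> ?P)) (g \<circ> \<phi> \<circ> inv_into U f)"
    using assms(1) U V(1) by (auto simp: smooth_map_def)
  have outer: "smooth_on (g ` V) (h \<circ> inv_into V g)"
    using assms(2) V(1) by (auto simp: C_inf_def)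
  have "(g \<circ> \<phi> \<circ> inv_into U f) ` (f ` (U \<inter> ?P)) \<subseteq> g ` V"
    by (auto simp: inv)
  from smooth_on_compose[OF op this outer inner]
  have "smooth_on (f ` (U \<inter> ?P)) (\<lambda>q. (h \<circ> inv_into V g) ((g \<circ> \<phi> \<circ> inv_into U f) q))" .
  then have "smooth_on (f ` (U \<inter> ?P)) (h \<circ> \<phi> \<circ> inv_into U f)"
    by (rule smooth_on_cong[OF op, rotated]) (auto simp: inv inv')
  then show "\<exists>P. open P \<and> y \<in> P \<and> smooth_on (f ` (U \<inter> P)) (h \<circ> \<phi> \<circ> inv_into U f)"
    using P V(2) by auto
qed

text \<open>
  The bump is transported from a chart with domain \<open>U\<close> and extended by zero. To see that the
  extension is smooth, the bump is made to vanish outside an open set \<open>P\<close> that is disjoint from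
  an open set \<open>Q\<close> containing the complement of \<open>U \<inter> W\<close>: the extension vanishes on \<open>Q\<close>, and
  \<open>U\<close> and \<open>Q\<close> cover the manifold. Such \<open>P\<close> and \<open>Q\<close> exist because a compact Hausdorff space is
  regular.
\<close>

lemma bump_function:
  assumes "compact (UNIV :: 'm set)" "open W" "x \<in> W"
  obtains u where "u \<in> C_inf atlas" "u x \<noteq> 0" "\<And>y. y \<notin> W \<Longrightarrow> u y = 0"
proof -
  obtain U f where U: "(U, f) \<in> atlas" "x \<in> U"
    by (rule chart_at)
  have inv: "inv_into V g (g z) = z" if "(V, g) \<in> atlas" "z \<in> V" for V g z
    using chart_inj[OF that(1)] that(2) by (rule inv_into_f_f)
  have "Hausdorff_space (euclidean :: 'm topology)"
    unfolding Hausdorff_space_def disjnt_def using hausdorff by (simp, blast)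
  then have "regular_space (euclidean :: 'm topology)"
    using assms(1) by (intro compact_Hausdorff_imp_regular_space) (auto simp: compact_space_def)
  moreover have "closedin euclidean (- (U \<inter> W))" "x \<in> topspace euclidean - (- (U \<inter> W))"
    using assms(2,3) U chart[OF U(1)] by (auto simp: open_Int closed_Compl)
  ultimately have "\<exists>P Q. openin euclidean P \<and> openin euclidean Q \<and> x \<in> P \<and> - (U \<inter> W) \<subseteq> Q \<and> disjnt P Q"
    unfolding regular_space_def by blast
  then obtain P Q where PQ: "open P" "open Q" "x \<in> P" "- (U \<inter> W) \<subseteq> Q" "P \<inter> Q = {}"
    by (auto simp: disjnt_def)
  have "open (f ` (U \<inter> P))" "f x \<in> f ` (U \<inter> P)"
    using chart_open_image[OF U(1)] PQ U by auto
  then obtain r where r: "r > 0" "ball (f x) r \<subseteq> f ` (U \<inter> P)"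
    unfolding open_contains_ball by blast
  define \<beta> where "\<beta> = (\<lambda>y. flat_exp 0 (r\<^sup>2 - (y - f x) \<bullet> (y - f x)))"
  define u where "u = (\<lambda>y. if y \<in> U then \<beta> (f y) else 0)"
  have supp: "y \<in> P" if "u y \<noteq> 0" for y
  proof -
    have y: "y \<in> U" "\<beta> (f y) \<noteq> 0"
      using that by (auto simp: u_def split: if_splits)
    then have "(norm (f y - f x))\<^sup>2 < r\<^sup>2"
      by (auto simp: \<beta>_def flat_exp_def power2_norm_eq_inner split: if_splits)
    then have "f y \<in> ball (f x) r"
      using r(1) power_less_imp_less_base[of _ 2 r] by (auto simp: dist_norm norm_minus_commute)
    then obtain z where "z \<in> U" "z \<in> P" "f y = f z"
      using r(2) by auto
    then show ?thesis
      using chart_inj[OF U(1)] y(1) by (metis inj_onD)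
  qed
  have "u \<in> C_inf atlas"
  proof (rule C_inf_localI)
    fix V g y assume V: "(V, g) \<in> atlas" "y \<in> V"
    show "\<exists>P. open P \<and> y \<in> P \<and> smooth_on (g ` (V \<inter> P)) (u \<circ> inv_into V g)"
    proof (cases "y \<in> U")
      case True
      have "open U"
        using chart[OF U(1)] by simp
      then have op: "open (g ` (V \<inter> U))"
        by (rule chart_open_image[OF V(1)])
      have "smooth_on (g ` (V \<inter> U)) (\<lambda>q. \<beta> ((f \<circ> inv_into V g) q))"
        unfolding \<beta>_def
        by (rule smooth_on_compose[OF op _ smooth_bump compatible[OF V(1) U(1)]]) simp
      then have "smooth_on (g ` (V \<inter> U)) (u \<circ> inv_into V g)"
        by (rule smooth_on_cong[OF op, rotated]) (auto simp: u_def inv[OF V(1)])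
      then show ?thesis
        using True \<open>open U\<close> by blast
    next
      case False
      have u0: "u z = 0" if "z \<in> Q" for z
        using supp[of z] PQ(5) that by blast
      have op: "open (g ` (V \<inter> Q))"
        by (rule chart_open_image[OF V(1) PQ(2)])
      then have "smooth_on (g ` (V \<inter> Q)) (\<lambda>q. 0 :: real)"
        by (simp add: smooth_on_def Ck_on_const)
      then have "smooth_on (g ` (V \<inter> Q)) (u \<circ> inv_into V g)"
        by (rule smooth_on_cong[OF op, rotated]) (auto simp: inv[OF V(1)] u0)
      then show ?thesis
        using False PQ(2,4) by blast
    qed
  qed
  moreover have "u x \<noteq> 0"
    using U(2) r(1) by (simp add: u_def \<beta>_def flat_exp_def)
  moreover have "u y = 0" if "y \<notin> W" for y
    using supp[of y] PQ(4,5) that by blast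
  ultimately show thesis
    by (rule that)
qed

lemma C_inf_separates_points:
  assumes "compact (UNIV :: 'm set)" "\<And>h. h \<in> C_inf atlas \<Longrightarrow> h x = h y"
  shows "x = y"
proof (rule ccontr)
  assume "x \<noteq> y"
  then have "open (- {y})" "x \<in> - {y}"
    by auto
  from bump_function[OF assms(1) this] obtain u where "u \<in> C_inf atlas" "u x \<noteq> 0" "u y = 0"
    by blast
  then show False
    using assms(2) by metis
qed

end

section \<open>Weil algebras\<close>

context weil_algebra
begin

lemma pr_real_eqI:
  assumes "n \<in> \<N>"
  shows "pr_real \<N> (of_real r + n) = r"
  unfolding pr_real_def
proof (rule the_equality)
  fix s assume "\<exists>m\<in>\<N>. of_real r + n = of_real s + m"
  then obtain m where m: "m \<in> \<N>" "of_real r + n = of_real s + m" by blast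
  have ideal: "is_ideal \<N>"
    using maximal by (simp add: is_maximal_ideal_def)
  then have "m + (- 1) * n \<in> \<N>"
    using m(1) assms unfolding is_ideal_def by blast
  moreover have "m + (- 1) * n = of_real (r - s)"
    using m(2) by (simp add: algebra_simps)
  ultimately have "(of_real (r - s) :: 'w) = 0"
    using inter_zero by (metis IntI rangeI singletonD)
  then show "s = r" by simp
qed (use assms in auto)

lemma nilpotent_element:
  assumes "n \<in> \<N>"
  obtains k where "n ^ k = 0"
proof -
  have "n ^ k \<in> ideal_power \<N> k" for k
    by (induction k) (auto intro!: span_base assms)
  then show thesis
    using nilpotent that by (metis singletonD)
qed

text \<open>
  An element with nonzero real part is a unit, being a nonzero scalar plus a nilpotent element. In
  particular it is not a zero divisor: if \<open>(r + n) b = 0\<close> with \<open>r \<noteq> 0\<close>, then multiplication by \<open>n\<close> acts on \<open>b\<close>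
  as the scalar \<open>- r\<close>, which the nilpotency of \<open>n\<close> permits only for \<open>b = 0\<close>.
\<close>

lemma mult_eq_0_pr_real:
  assumes "a * b = 0" "pr_real \<N> a \<noteq> 0"
  shows "b = 0"
proof -
  obtain r n where a: "a = of_real r + n" "n \<in> \<N>"
    using sum_UNIV by blast
  then have r: "r \<noteq> 0"
    using assms(2) pr_real_eqI by simp
  obtain k where k: "n ^ k = 0"
    using nilpotent_element[OF a(2)] .
  have "n * b = (- r) *\<^sub>R b"
    using assms(1) a(1) by (simp add: algebra_simps scaleR_conv_of_real eq_neg_iff_add_eq_0)
  then have "n ^ j * b = (- r) ^ j *\<^sub>R b" for j
    by (induction j) (simp_all add: mult.assoc)
  from this[of k] show ?thesis
    using k r by simp
qed

end

section \<open>Fixed points of the lift\<close>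

lemma algebra_morphismD:
  assumes "algebra_morphism atlas \<xi>" "f \<in> C_inf atlas"
  shows "g \<in> C_inf atlas \<Longrightarrow> \<xi> (\<lambda>x. f x + g x) = \<xi> f + \<xi> g"
    and "g \<in> C_inf atlas \<Longrightarrow> \<xi> (\<lambda>x. f x * g x) = \<xi> f * \<xi> g"
    and "\<xi> (\<lambda>x. c * f x) = c *\<^sub>R \<xi> f"
  using assms by (simp_all add: algebra_morphism_def)

text \<open>
  A morphism over \<open>x\<close> only sees the germ of a function at \<open>x\<close>: multiplying the difference of
  \<open>h\<close> and \<open>k\<close> by a bump that vanishes outside \<open>W\<close> gives zero, while the bump itself is
  sent to an element with nonzero real part.
\<close>

lemma weil_fibre_local:
  fixes \<N> :: "'w::{comm_ring_1, real_algebra_1} set"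
  assumes "smooth_manifold atlas" "compact (UNIV :: 'm::{t2_space, second_countable_topology} set)"
    and "weil_algebra \<N>"
    and \<xi>: "\<xi> \<in> weil_fibre atlas \<N> x"
    and W: "open W" "x \<in> W" "\<And>y. y \<in> W \<Longrightarrow> h y = k y"
    and hk: "h \<in> C_inf atlas" "k \<in> C_inf atlas"
  shows "\<xi> h = \<xi> (k :: 'm \<Rightarrow> real)"
proof -
  interpret smooth_manifold atlas by fact
  interpret weil_algebra \<N> by fact
  obtain u where u: "u \<in> C_inf atlas" "u x \<noteq> 0" "\<And>y. y \<notin> W \<Longrightarrow> u y = 0"
    by (rule bump_function[OF assms(2) W(1,2)]) blast
  have mor: "algebra_morphism atlas \<xi>" and pr: "pr_real \<N> (\<xi> u) = u x"
    using \<xi> u(1) by (auto simp: weil_fibre_def)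
  have k': "(\<lambda>y. (- 1) * k y) \<in> C_inf atlas"
    by (rule C_inf_cmult[OF hk(2)])
  let ?d = "\<lambda>y. h y + (- 1) * k y"
  have d: "?d \<in> C_inf atlas"
    by (rule C_inf_add[OF hk(1) k'])
  have "(\<lambda>y. u y * ?d y) = (\<lambda>y. 0)"
    using W(3) u(3) by fastforce
  moreover have "\<xi> (\<lambda>y. u y * ?d y) = \<xi> u * \<xi> ?d"
    by (rule algebra_morphismD(2)[OF mor u(1) d])
  moreover have "\<xi> (\<lambda>y. 0) = 0"
    using algebra_morphismD(3)[OF mor hk(1), of 0] by simp
  ultimately have "\<xi> u * \<xi> ?d = 0"
    by simp
  then have "\<xi> ?d = 0"
    by (rule mult_eq_0_pr_real) (use pr u(2) in simp)
  moreover have "\<xi> ?d = \<xi> h + (- 1) *\<^sub>R \<xi> k"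
    using algebra_morphismD(1)[OF mor hk(1) k'] algebra_morphismD(3)[OF mor hk(2), of "- 1"]
    by (simp only:)
  ultimately show ?thesis by simp
qed

lemma evaluation_in_weil_fibre:
  fixes \<N> :: "'w::{comm_ring_1, real_algebra_1} set"
  assumes "smooth_manifold atlas" "weil_algebra \<N>"
  shows "restrict (\<lambda>h. of_real (h x)) (C_inf atlas) \<in> weil_fibre atlas \<N> x"
proof -
  interpret smooth_manifold atlas by fact
  interpret weil_algebra \<N> by fact
  have "0 \<in> \<N>"
    using inter_zero by auto
  then have "pr_real \<N> (of_real r) = r" for r
    using pr_real_eqI[of 0 r] by simp
  then show ?thesis
    by (auto simp: weil_fibre_def algebra_morphism_def C_inf_const C_inf_add C_inf_cmult
        scaleR_conv_of_real C_inf_mult)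
qed

theorem lemma4p2:
  fixes atlas :: "('m::{t2_space, second_countable_topology}, 'e::real_inner) chart set"
    and \<N> :: "'w::{comm_ring_1, real_algebra_1} set"
    and \<phi> :: "'m \<Rightarrow> 'm"
  assumes "smooth_manifold atlas"
    and "compact (UNIV :: 'm set)"
    and "connected (UNIV :: 'm set)"
    and "weil_algebra \<N>"
    and "diffeomorphism atlas atlas \<phi>"
  shows "(\<forall>W. Fix UNIV \<phi> \<noteq> {} \<and> open W \<and> W \<noteq> {} \<and> W \<subseteq> Fix UNIV \<phi> \<longrightarrow>
            Fix (weil_bundle atlas \<N>) (weil_lift atlas \<phi>) \<noteq> {} \<and>
            (\<Union>x\<in>W. weil_fibre atlas \<N> x) \<subseteq> Fix (weil_bundle atlas \<N>) (weil_lift atlas \<phi>)) \<and>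
         (Fix (weil_bundle atlas \<N>) (weil_lift atlas \<phi>) \<noteq> {} \<longrightarrow>
            weil_proj atlas \<N> ` Fix (weil_bundle atlas \<N>) (weil_lift atlas \<phi>) \<subseteq> Fix UNIV \<phi>)"
proof -
  interpret smooth_manifold atlas by fact
  have comp: "h \<circ> \<phi> \<in> C_inf atlas" if "h \<in> C_inf atlas" for h
    using assms(5) that by (auto simp: diffeomorphism_def intro: C_inf_compose)
  have fixed: "\<xi> \<in> Fix (weil_bundle atlas \<N>) (weil_lift atlas \<phi>)"
    if W: "open W" "W \<subseteq> Fix UNIV \<phi>" "x \<in> W" and \<xi>: "\<xi> \<in> weil_fibre atlas \<N> x" for W x \<xi>
  proof -
    have "\<xi> (h \<circ> \<phi>) = \<xi> h" if "h \<in> C_inf atlas" for h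
      by (rule weil_fibre_local[OF assms(1,2,4) \<xi> W(1,3) _ comp[OF that] that])
         (use W(2) in \<open>auto simp: Fix_def\<close>)
    moreover have "\<xi> \<in> extensional (C_inf atlas)"
      using \<xi> by (simp add: weil_fibre_def algebra_morphism_def)
    ultimately have "weil_lift atlas \<phi> \<xi> = \<xi>"
      unfolding weil_lift_def by (auto simp: restrict_def extensional_def)
    then show ?thesis
      using \<xi> by (auto simp: Fix_def weil_bundle_def)
  qed
  have proj: "weil_proj atlas \<N> \<xi> \<in> Fix UNIV \<phi>"
    if \<xi>: "\<xi> \<in> Fix (weil_bundle atlas \<N>) (weil_lift atlas \<phi>)" for \<xi>
  proof -
    obtain x where x: "\<xi> \<in> weil_fibre atlas \<N> x" and lift: "weil_lift atlas \<phi> \<xi> = \<xi>"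
      using \<xi> by (auto simp: Fix_def weil_bundle_def)
    have pr: "pr_real \<N> (\<xi> h) = h y" if "\<xi> \<in> weil_fibre atlas \<N> y" "h \<in> C_inf atlas" for h y
      using that by (simp add: weil_fibre_def)
    have "weil_proj atlas \<N> \<xi> = x"
      unfolding weil_proj_def
      by (rule the_equality, rule x, rule C_inf_separates_points[OF assms(2)]) (metis pr x)
    moreover have "\<phi> x = x"
    proof (rule C_inf_separates_points[OF assms(2)])
      fix h assume h: "h \<in> C_inf atlas"
      have "\<xi> (h \<circ> \<phi>) = \<xi> h"
        using fun_cong[OF lift, of h] h by (simp add: weil_lift_def)
      then show "h (\<phi> x) = h x"
        using pr[OF x h] pr[OF x comp[OF h]] by simp
    qed
    ultimately show ?thesis
      by (simp add: Fix_def)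
  qed
  show ?thesis
  proof (intro conjI allI impI)
    fix W assume W: "Fix UNIV \<phi> \<noteq> {} \<and> open W \<and> W \<noteq> {} \<and> W \<subseteq> Fix UNIV \<phi>"
    show sub: "(\<Union>x\<in>W. weil_fibre atlas \<N> x) \<subseteq> Fix (weil_bundle atlas \<N>) (weil_lift atlas \<phi>)"
      by (intro UN_least subsetI, rule fixed[of W]) (use W in auto)
    obtain x where "x \<in> W"
      using W by blast
    then show "Fix (weil_bundle atlas \<N>) (weil_lift atlas \<phi>) \<noteq> {}"
      using sub evaluation_in_weil_fibre[OF assms(1,4), of x] by blast
  next
    show "weil_proj atlas \<N> ` Fix (weil_bundle atlas \<N>) (weil_lift atlas \<phi>) \<subseteq> Fix UNIV \<phi>"
      using proj by (rule image_subsetI)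
  qed
qed

end
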